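(* Fix an integer $N\ge1$ and distinct $N$-tuples $\mathbf{m}=(m_0<\cdots<m_{N-1})$ and $\mathbf{n}=(n_0<\cdots<n_{N-1})$ of non-negative integers with strictly increasing entries such that $m_j\le n_j$ for all $j$. 1. The symmetric function $$f:(0,\infty)^N\to\mathbb{R};\quad\mathbf{u}\mapsto\frac{s_{\mathbf{n}}(\mathbf{u})}{s_{\mathbf{m}}(\mathbf{u})}$$ is strictly increasing in each coordinate and, for any $\rho\in(0,\infty)$, is bounded above by the constant $\rho^{|\mathbf{n}-\mathbf{m}|/2}\,V(\mathbf{n})/V(\mathbf{m})=f(\sqrt{\rho},\ldots,\sqrt{\rho})$ on $(0,\sqrt{\rho}]^N$. 2. Suppose that $n_j=j$ for $j=0,\ldots,k-1$ but $n_k>k$, where $0\le k\le N$ and the final condition holds vacuously if $k=N$. Then $f=s_{\mathbf{n}}/s_{\mathbf{m}}$ is non-decreasing in each coordinate on its extended domain of definition $$\mathcal{U}_k:=\{\mathbf{u}\in[0,\infty)^N:\text{at most }k\text{ coordinates of }\mathbf{u}\text{ are }0\}.$$ 3. Suppose that $m_j=n_j=j$ for $j=0,\ldots,k-1$ and $m_k,n_k>k$, where $0\le k\le N$ and the final condition holds vacuously if $k=N$. Then $f=s_{\mathbf{n}}/s_{\mathbf{m}}$ is strictly increasing in each coordinate on $\mathcal{U}_k$.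
   Context: For a tuple $\mathbf{n}=(n_0<\cdots<n_{N-1})$ of non-negative integers, the Schur polynomial $s_{\mathbf{n}}(u_1,\ldots,u_N)$ is the unique polynomial extension of the rational expression $\det(u_i^{n_{j-1}})_{i,j=1}^N/\det(u_i^{j-1})_{i,j=1}^N$. $|\mathbf{n}-\mathbf{m}|:=\sum_{j=0}^{N-1}(n_j-m_j)$. For an $N$-tuple $\mathbf{a}=(a_1,\ldots,a_N)$, $V(\mathbf{a}):=\prod_{1\le k<l\le N}(a_l-a_k)$ (empty product equal to $1$). A function on $X\subseteq\mathbb{R}^N$ is strictly increasing (respectively non-decreasing) in each coordinate if $f(\mathbf{u})<f(\mathbf{v})$ (respectively $f(\mathbf{u})\le f(\mathbf{v})$) whenever $\mathbf{u},\mathbf{v}\in X$ differ in exactly one coordinate $i$ and $u_i<v_i$. *)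

theory Defs
  imports Complex_Main "HOL-Library.FuncSet" "HOL-Combinatorics.Permutations"
    "Jordan_Normal_Form.Determinant"
begin

text \<open>
  An \<open>N\<close>-tuple is a function on \<open>nat\<close> read on the indices \<open>0, \<dots>, N - 1\<close>, so the variable
  \<open>u\<^sub>i\<close> of the mathematical text is \<open>u (i - 1)\<close>. Domains such as \<open>(0, \<infinity>)\<^sup>N\<close> are extensional
  function spaces \<open>{..<N} \<rightarrow>\<^sub>E {0<..}\<close>.
\<close>

definition polynomial_fun :: "nat \<Rightarrow> ((nat \<Rightarrow> real) \<Rightarrow> real) \<Rightarrow> bool" where
  "polynomial_fun N p \<longleftrightarrow>
     (\<exists>(A :: (nat \<Rightarrow> nat) set) c. finite A \<and>
        (\<forall>u. p u = (\<Sum>\<alpha>\<in>A. c \<alpha> * (\<Prod>i<N. u i ^ \<alpha> i))))"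

definition alternant :: "nat \<Rightarrow> (nat \<Rightarrow> nat) \<Rightarrow> (nat \<Rightarrow> real) \<Rightarrow> real" where
  "alternant N n u = det (mat N N (\<lambda>(i, j). u i ^ n j))"

text \<open>
  The rational expression is defined where its denominator, the Vandermonde determinant, does
  not vanish; this set is dense, so at most one polynomial function extends it. (Over the infinite
  field of reals polynomials and polynomial functions may be identified.)
\<close>

definition schur :: "nat \<Rightarrow> (nat \<Rightarrow> nat) \<Rightarrow> (nat \<Rightarrow> real) \<Rightarrow> real" where
  "schur N n = (THE p. polynomial_fun N p \<and>
     (\<forall>u. alternant N (\<lambda>j. j) u \<noteq> 0 \<longrightarrow> p u = alternant N n u / alternant N (\<lambda>j. j) u))"

definition tuple_diff :: "nat \<Rightarrow> (nat \<Rightarrow> nat) \<Rightarrow> (nat \<Rightarrow> nat) \<Rightarrow> int" where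
  "tuple_diff N n m = (\<Sum>j<N. int (n j) - int (m j))"

definition vandermonde :: "nat \<Rightarrow> (nat \<Rightarrow> real) \<Rightarrow> real" where
  "vandermonde N a = (\<Prod>(k, l)\<in>{(k, l). k < l \<and> l < N}. a l - a k)"

definition strictly_increasing_coords ::
    "nat \<Rightarrow> (nat \<Rightarrow> real) set \<Rightarrow> ((nat \<Rightarrow> real) \<Rightarrow> real) \<Rightarrow> bool" where
  "strictly_increasing_coords N X f \<longleftrightarrow>
     (\<forall>u\<in>X. \<forall>v\<in>X. \<forall>i<N. (\<forall>j<N. j \<noteq> i \<longrightarrow> u j = v j) \<and> u i < v i \<longrightarrow> f u < f v)"

definition nondecreasing_coords ::
    "nat \<Rightarrow> (nat \<Rightarrow> real) set \<Rightarrow> ((nat \<Rightarrow> real) \<Rightarrow> real) \<Rightarrow> bool" where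
  "nondecreasing_coords N X f \<longleftrightarrow>
     (\<forall>u\<in>X. \<forall>v\<in>X. \<forall>i<N. (\<forall>j<N. j \<noteq> i \<longrightarrow> u j = v j) \<and> u i < v i \<longrightarrow> f u \<le> f v)"

definition symmetric_on :: "nat \<Rightarrow> (nat \<Rightarrow> real) set \<Rightarrow> ((nat \<Rightarrow> real) \<Rightarrow> real) \<Rightarrow> bool" where
  "symmetric_on N X f \<longleftrightarrow> (\<forall>u\<in>X. \<forall>\<pi>. \<pi> permutes {..<N} \<longrightarrow> f (u \<circ> \<pi>) = f u)"

definition few_zeros :: "nat \<Rightarrow> nat \<Rightarrow> (nat \<Rightarrow> real) set" where
  "few_zeros N k = {u \<in> {..<N} \<rightarrow>\<^sub>E {0..}. card {i \<in> {..<N}. u i = 0} \<le> k}"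

text \<open>
  Division by zero yields zero in HOL, so a quotient being defined on a set has to be asserted
  separately.
\<close>

definition quotient_defined_on :: "(nat \<Rightarrow> real) set \<Rightarrow> ((nat \<Rightarrow> real) \<Rightarrow> real) \<Rightarrow> bool" where
  "quotient_defined_on X q \<longleftrightarrow> (\<forall>u\<in>X. q u \<noteq> 0)"

end

theory Submission imports Defs begin

text \<open>
  The quotient \<open>f\<close> increases because of a Pluecker relation. Suppose that \<open>m\<close> and \<open>n\<close> differ in a single
  entry, which is \<open>a\<close> in \<open>m\<close> and \<open>b > a\<close> in \<open>n\<close>, and let \<open>R\<close> be the tuple of the common entries. Fix
  all variables but one, say \<open>u\<close>, and move the remaining one from \<open>x\<close> to \<open>y\<close>. Sylvester's identity for
  the alternant in the points \<open>u, x, y\<close> and the exponents \<open>R, a, b\<close>, divided by Vandermonde determinants,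
  is
  \<open>s\<^sub>m(u, x) s\<^sub>n(u, y) - s\<^sub>n(u, x) s\<^sub>m(u, y) = (y - x) s\<^sub>R(u) s\<^sub>w(u, x, y)\<close>,
  where \<open>w\<close> is the increasing arrangement of \<open>R, a, b\<close> (\<open>branching_schur_plucker\<close>). Where the Schur
  polynomials involved are positive, the cross-multiplied inequality \<open>f(u, x) < f(u, y)\<close> follows. An arbitrary
  pair \<open>m \<le> n\<close> is joined by the chain that raises the entries one at a time, from the last one down to
  the first, so that every member of the chain is strictly increasing; the ratios of consecutive
  members multiply to \<open>f\<close> (\<open>branching_schur_ratio_less\<close>).

  Positivity comes from the branching rule: a Schur polynomial in \<open>N + 1\<close> variables is the sum, over the
  tuples \<open>\<nu>\<close> that interlace with \<open>n\<close>, of a power of the last variable times the Schur polynomial of \<open>\<nu>\<close>.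
  Iterating it presents the Schur polynomial with non-negative coefficients
  (\<open>alternant_eq_vandermonde_branching_schur\<close>, \<open>schur_eq_branching_schur\<close>). If \<open>n\<^sub>j = j\<close> for \<open>j < k\<close>, a vanishing
  last variable leaves a branch in which \<open>\<nu>\<^sub>j = j\<close> for \<open>j < k - 1\<close>, so up to \<open>k\<close> zeros are harmless
  (\<open>branching_schur_pos\<close>).

  All three parts are instances of strict monotonicity on the points with at most \<open>k\<close> zeros, for tuples
  that both start with \<open>0, \<dots>, k - 1\<close>: the open orthant is the case \<open>k = 0\<close>, and in the second part
  \<open>j \<le> m\<^sub>j \<le> n\<^sub>j = j\<close> forces \<open>m\<close> to start in the same way.
  The upper bound is monotonicity, one coordinate after the other, up to the point \<open>(c, \<dots>, c)\<close> with
  \<open>c\<^sup>2 = \<rho>\<close>. The value there is a limit of the values at \<open>(c, c q, c q\<^sup>2, \<dots>)\<close> as \<open>q \<rightarrow> 1\<close>: along a geometric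
  progression the alternant is itself a Vandermonde determinant, in the points \<open>q\<close> to the power \<open>n\<^sub>j\<close>
  (\<open>branching_schur_principal\<close>).
\<close>

section \<open>Determinant identities\<close>

lemma det_swap_indices:
  "det (mat N N (\<lambda>(i, j). g i j)) = det (mat N N (\<lambda>(j, i). g i j))"
  by (subst det_transpose[symmetric, of _ N]) (auto intro!: arg_cong[of _ _ det] eq_matI)

lemma det_row_factors:
  "det (mat N N (\<lambda>(i, j). a i * g i j)) = (\<Prod>i<N. a i) * det (mat N N (\<lambda>(i, j). g i j))"
  for a :: "nat \<Rightarrow> 'a :: comm_ring_1"
proof -
  have "det (mat N N (\<lambda>(i, j). a i * g i j)) =
      (\<Sum>p | p permutes {0..<N}. signof p * ((\<Prod>i<N. a i) * (\<Prod>i=0..<N. mat N N (\<lambda>(i, j). g i j) $$ (i, p i))))"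
    unfolding det_def
    by (auto intro!: sum.cong arg_cong2[of _ _ _ _ "(*)"] prod.cong
      simp: prod.distrib[symmetric] permutes_in_image atLeast0LessThan dest: permutes_in_image)
  then show ?thesis
    by (simp add: det_def sum_distrib_left mult_ac)
qed

text \<open>
  Multilinearity of the determinant in all columns at once.
\<close>
lemma det_column_sums:
  fixes g :: "nat \<Rightarrow> nat \<Rightarrow> 'b \<Rightarrow> 'a :: comm_ring_1"
  assumes fin: "\<And>j. j < N \<Longrightarrow> finite (I j)"
  shows "det (mat N N (\<lambda>(i, j). \<Sum>t\<in>I j. g i j t)) =
    (\<Sum>\<nu>\<in>PiE {..<N} I. det (mat N N (\<lambda>(i, j). g i j (\<nu> j))))"
proof -
  have tr: "det (mat N N (\<lambda>(i, j). h i j)) = (\<Sum>p | p permutes {0..<N}. signof p * (\<Prod>j<N. h (p j) j))"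
    for h :: "nat \<Rightarrow> nat \<Rightarrow> 'a"
  proof -
    have "det (mat N N (\<lambda>(i, j). h i j)) = det (mat N N (\<lambda>(j, i). h i j))"
      by (rule det_swap_indices)
    also have "\<dots> = (\<Sum>p | p permutes {0..<N}. signof p * (\<Prod>j<N. h (p j) j))"
      unfolding det_def
      by (auto intro!: sum.cong prod.cong arg_cong2[of _ _ _ _ "(*)"]
        simp: permutes_in_image atLeast0LessThan)
    finally show ?thesis .
  qed
  have "det (mat N N (\<lambda>(i, j). \<Sum>t\<in>I j. g i j t)) =
      (\<Sum>p | p permutes {0..<N}. signof p * (\<Sum>\<nu>\<in>PiE {..<N} I. \<Prod>j<N. g (p j) j (\<nu> j)))"
    unfolding tr by (subst prod_sum_PiE) (use fin in auto)
  also have "\<dots> = (\<Sum>\<nu>\<in>PiE {..<N} I. det (mat N N (\<lambda>(i, j). g i j (\<nu> j))))"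
    unfolding tr sum_distrib_left by (rule sum.swap)
  finally show ?thesis .
qed

lemma det_2_by_2:
  "det (mat 2 2 (\<lambda>(i, j). d i j)) = d 0 0 * d 1 1 - d 0 1 * d 1 (0::nat)" for d :: "nat \<Rightarrow> nat \<Rightarrow> 'a :: comm_ring_1"
proof -
  have "det (mat 2 2 (\<lambda>(i, j). d i j)) =
      (\<Sum>j<2. mat 2 2 (\<lambda>(i, j). d i j) $$ (0, j) * cofactor (mat 2 2 (\<lambda>(i, j). d i j)) 0 j)"
    by (rule laplace_expansion_row) auto
  then show ?thesis
    by (simp add: numeral_2_eq_2 cofactor_def mat_delete_def det_single)
qed

text \<open>
  Clearing the lower left block by row operations leaves the Schur complement in the lower right
  corner.
\<close>
lemma det_schur_complement:
  fixes A :: "'a :: idom mat"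
  assumes A: "A \<in> carrier_mat r r" and A': "A' \<in> carrier_mat r r" and inv: "A' * A = 1\<^sub>m r"
    and B: "B \<in> carrier_mat r s" and C: "C \<in> carrier_mat s r" and D: "D \<in> carrier_mat s s"
  shows "det (four_block_mat A B C D) = det A * det (D - C * A' * B)"
proof -
  let ?L = "four_block_mat (1\<^sub>m r) (0\<^sub>m r s) (- (C * A')) (1\<^sub>m s)"
  have "?L * four_block_mat A B C D = four_block_mat A B (0\<^sub>m s r) (D - C * A' * B)"
  proof -
    have "- (C * A') * A + C = 0\<^sub>m s r"
    proof -
      have "- (C * A') * A = - (C * A' * A)" using A A' C by auto
      also have "C * A' * A = C" using A A' C inv by (simp add: assoc_mult_mat[OF C A' A])
      finally show ?thesis using C by simp
    qed
    moreover have "- (C * A') * B + D = D - C * A' * B"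
      using A' B C D by (intro eq_matI) auto
    ultimately show ?thesis
      using A A' B C D by (subst mult_four_block_mat[of _ r r _ s _ s]) auto
  qed
  moreover have "det ?L = 1"
    using A' C by (subst det_four_block_mat_upper_right_zero[of _ r _ s]) auto
  moreover have "det (?L * four_block_mat A B C D) = det ?L * det (four_block_mat A B C D)"
    by (rule det_mult[of _ "r + s"]) (use A A' C D in auto)
  moreover have "det (four_block_mat A B (0\<^sub>m s r) (D - C * A' * B)) = det A * det (D - C * A' * B)"
    by (rule det_four_block_mat_lower_left_zero) (use A A' B C D in auto)
  ultimately show ?thesis by simp
qed

text \<open>
  By the Schur complement of the leading \<open>r \<times> r\<close> block, each minor bordering that block is its
  determinant times one entry \<open>\<sigma> k l\<close> of a \<open>2 \<times> 2\<close> matrix, and the full determinant is its determinant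
  times \<open>det \<sigma>\<close>; expanding \<open>det \<sigma>\<close> gives the identity.
\<close>
lemma sylvester_identity:
  fixes F :: "nat \<Rightarrow> nat \<Rightarrow> 'a :: field" and r :: nat
  defines "\<beta> \<equiv> \<lambda>k l. det (mat (Suc r) (Suc r) (\<lambda>(p, q). F (if p < r then p else k) (if q < r then q else l)))"
  assumes nz: "det (mat r r (\<lambda>(p, q). F p q)) \<noteq> 0"
  shows "det (mat r r (\<lambda>(p, q). F p q)) * det (mat (Suc (Suc r)) (Suc (Suc r)) (\<lambda>(p, q). F p q)) =
    \<beta> r r * \<beta> (Suc r) (Suc r) - \<beta> r (Suc r) * \<beta> (Suc r) r"
proof -
  define A where "A = mat r r (\<lambda>(p, q). F p q)"
  have A: "A \<in> carrier_mat r r" by (simp add: A_def)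
  from det_non_zero_imp_unit[OF A, of "()"] nz
  obtain A' where A': "A' \<in> carrier_mat r r" "A' * A = 1\<^sub>m r"
    unfolding A_def[symmetric] Units_def ring_mat_def by auto
  define B where "B = mat r 2 (\<lambda>(p, q). F p (r + q))"
  define C where "C = mat 2 r (\<lambda>(p, q). F (r + p) q)"
  define \<sigma> where "\<sigma> = (\<lambda>k l. F (r + k) (r + l) - (C * A' * B) $$ (k, l))"
  have minor: "\<beta> (r + k) (r + l) = det A * \<sigma> k l" if kl: "k < 2" "l < 2" for k l
  proof -
    let ?b = "mat r 1 (\<lambda>(p, q). F p (r + l))" and ?c = "mat 1 r (\<lambda>(p, q). F (r + k) q)"
      and ?d = "mat 1 1 (\<lambda>_. F (r + k) (r + l))"
    have "\<beta> (r + k) (r + l) = det (four_block_mat A ?b ?c ?d)"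
      unfolding \<beta>_def A_def by (intro arg_cong[of _ _ det] eq_matI) auto
    also have "\<dots> = det A * det (?d - ?c * A' * ?b)"
      by (rule det_schur_complement) (use A A' in auto)
    also have "det (?d - ?c * A' * ?b) = F (r + k) (r + l) - (?c * A' * ?b) $$ (0, 0)"
      using A' by (subst det_single) auto
    also have "(?c * A' * ?b) $$ (0, 0) = (C * A' * B) $$ (k, l)"
    proof -
      have "row ?c 0 = row C k" "col ?b 0 = col B l" using kl by (auto simp: C_def B_def)
      moreover have "row (?c * A') 0 = row (C * A') k"
        using kl A' calculation(1) by (intro eq_vecI) (auto simp: C_def)
      ultimately show ?thesis using kl A' by (simp add: C_def B_def)
    qed
    finally show ?thesis by (simp add: \<sigma>_def)
  qed
  have "det (mat (Suc (Suc r)) (Suc (Suc r)) (\<lambda>(p, q). F p q)) =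
      det (four_block_mat A B C (mat 2 2 (\<lambda>(p, q). F (r + p) (r + q))))"
    unfolding A_def B_def C_def by (intro arg_cong[of _ _ det] eq_matI) auto
  also have "\<dots> = det A * det (mat 2 2 (\<lambda>(p, q). F (r + p) (r + q)) - C * A' * B)"
    by (rule det_schur_complement) (use A A' in \<open>auto simp: B_def C_def\<close>)
  also have "mat 2 2 (\<lambda>(p, q). F (r + p) (r + q)) - C * A' * B = mat 2 2 (\<lambda>(p, q). \<sigma> p q)"
    using A' by (intro eq_matI) (auto simp: \<sigma>_def B_def C_def)
  finally have full: "det (mat (Suc (Suc r)) (Suc (Suc r)) (\<lambda>(p, q). F p q)) =
      det A * (\<sigma> 0 0 * \<sigma> 1 1 - \<sigma> 0 1 * \<sigma> 1 0)"
    by (simp only: det_2_by_2)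
  show ?thesis
    unfolding A_def[symmetric] full
    using minor[of 0 0] minor[of 0 1] minor[of 1 0] minor[of 1 1]
    by (simp add: algebra_simps)
qed

section \<open>Alternants\<close>
lemma alternant_permute_exponents:
  assumes p: "p permutes {..<N}"
  shows "alternant N (n \<circ> p) u = signof p * alternant N n u"
proof -
  let ?T = "mat N N (\<lambda>(j, i). u i ^ n j)"
  have tr: "alternant N n' u = det (mat N N (\<lambda>(j, i). u i ^ n' j))" for n'
    unfolding alternant_def by (rule det_swap_indices)
  have "alternant N (n \<circ> p) u = det (mat N N (\<lambda>(j, i). ?T $$ (p j, i)))"
    unfolding tr using permutes_in_image[OF p]
    by (intro arg_cong[of _ _ det] eq_matI) auto
  also have "\<dots> = signof p * det ?T"
    by (rule det_permute_rows) (use p in \<open>auto simp: atLeast0LessThan\<close>)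
  finally show ?thesis by (simp add: tr)
qed

lemma alternant_permute_points:
  assumes p: "p permutes {..<N}"
  shows "alternant N n (u \<circ> p) = signof p * alternant N n u"
proof -
  let ?T = "mat N N (\<lambda>(i, j). u i ^ n j)"
  have "alternant N n (u \<circ> p) = det (mat N N (\<lambda>(i, j). ?T $$ (p i, j)))"
    unfolding alternant_def using permutes_in_image[OF p]
    by (intro arg_cong[of _ _ det] eq_matI) auto
  also have "\<dots> = signof p * det ?T"
    by (rule det_permute_rows) (use p in \<open>auto simp: atLeast0LessThan\<close>)
  finally show ?thesis by (simp add: alternant_def)
qed

lemma alternant_cong:
  assumes "\<And>j. j < N \<Longrightarrow> n j = n' j" "\<And>i. i < N \<Longrightarrow> u i = u' i"
  shows "alternant N n u = alternant N n' u'"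
  unfolding alternant_def using assms by (intro arg_cong[of _ _ det] eq_matI) auto

text \<open>
  The cycle that moves position \<open>k\<close> to the last position \<open>r\<close> and keeps the order of the others. It
  brings an alternant with increasing exponents into the bordered form of Sylvester's identity.
\<close>
definition shift_to_last :: "nat \<Rightarrow> nat \<Rightarrow> nat \<Rightarrow> nat" where
  "shift_to_last r k i = (if i = r then k else if k \<le> i \<and> i < r then Suc i else i)"

lemma permutes_shift_to_last:
  assumes "k \<le> r"
  shows "shift_to_last r k permutes {..<Suc r}"
proof (rule bij_imp_permutes)
  have "inj_on (shift_to_last r k) {..<Suc r}"
    using assms by (auto simp: inj_on_def shift_to_last_def split: if_splits)
  moreover have "shift_to_last r k ` {..<Suc r} \<subseteq> {..<Suc r}"
    using assms by (auto simp: shift_to_last_def)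
  ultimately show "bij_betw (shift_to_last r k) {..<Suc r} {..<Suc r}"
    by (simp add: bij_betw_def endo_inj_surj)
qed (use assms in \<open>auto simp: shift_to_last_def\<close>)

definition omit_entry :: "(nat \<Rightarrow> 'a) \<Rightarrow> nat \<Rightarrow> nat \<Rightarrow> 'a" where
  "omit_entry m k j = (if j < k then m j else m (Suc j))"

definition insert_after :: "(nat \<Rightarrow> 'a) \<Rightarrow> nat \<Rightarrow> 'a \<Rightarrow> nat \<Rightarrow> 'a" where
  "insert_after m k b j = (if j \<le> k then m j else if j = Suc k then b else m (j - 1))"

text \<open>
  Sylvester's identity for the exponents \<open>R, m k, n k\<close>, where \<open>R\<close> is \<open>m\<close> without its \<open>k\<close>-th entry.
  Sorting \<open>R, m k\<close> and \<open>R, n k\<close> takes the same cycle, so its sign occurs squared in every product;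
  sorting \<open>R, m k, n k\<close> takes the square of a cycle, which is even. No sign survives.
\<close>
lemma alternant_plucker:
  fixes m n :: "nat \<Rightarrow> nat" and v :: "nat \<Rightarrow> real"
  assumes k: "k \<le> r" and eq: "\<forall>j\<le>r. j \<noteq> k \<longrightarrow> n j = m j"
    and nz: "alternant r (omit_entry m k) v \<noteq> 0"
  defines "v' \<equiv> v(r := v (Suc r))"
  shows "alternant r (omit_entry m k) v * alternant (Suc (Suc r)) (insert_after m k (n k)) v =
    alternant (Suc r) m v * alternant (Suc r) n v' - alternant (Suc r) n v * alternant (Suc r) m v'"
proof -
  let ?p = "shift_to_last r k" and ?p' = "shift_to_last (Suc r) k"
  let ?s = "signof ?p :: real" and ?s' = "signof ?p' :: real"
  let ?R = "omit_entry m k" and ?w = "insert_after m k (n k)"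
  have s: "?s * ?s = 1" "?s' * ?s' = 1" by (simp_all add: sign_def)
  \<comment> \<open>The first shift sends \<open>m k\<close> to the end; then \<open>n k\<close> is at position \<open>k\<close>, and the second shift moves
    it behind.\<close>
  define e where "e = ?w \<circ> ?p' \<circ> ?p'"
  have e: "e q = (if q < r then ?R q else if q = r then m k else n k)" if "q < Suc (Suc r)" for q
    using that k by (auto simp: e_def shift_to_last_def omit_entry_def insert_after_def)
  have border: "alternant (Suc r) (\<lambda>q. e (if q < r then q else l)) (\<lambda>p. v (if p < r then p else i)) =
      ?s * alternant (Suc r) (if l = r then m else n) (if i = r then v else v')"
    if "l = r \<or> l = Suc r" "i = r \<or> i = Suc r" for l i
    unfolding alternant_permute_exponents[OF permutes_shift_to_last[OF k], symmetric]
    using that k eq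
    by (intro alternant_cong) (auto simp: e v'_def shift_to_last_def omit_entry_def less_Suc_eq)
  have "alternant r e v = alternant r ?R v"
    by (intro alternant_cong) (auto simp: e)
  moreover have "alternant (Suc (Suc r)) e v = alternant (Suc (Suc r)) ?w v"
    using k s(2) unfolding e_def
    by (simp add: alternant_permute_exponents[OF permutes_shift_to_last] flip: mult.assoc)
  moreover have "alternant r e v * alternant (Suc (Suc r)) e v =
      (?s * alternant (Suc r) m v) * (?s * alternant (Suc r) n v') -
      (?s * alternant (Suc r) n v) * (?s * alternant (Suc r) m v')"
    using sylvester_identity[of r "\<lambda>p q. v p ^ e q"] nz calculation(1)
    unfolding alternant_def[symmetric]
    by (simp add: border)
  moreover have "\<dots> = (?s * ?s) * (alternant (Suc r) m v * alternant (Suc r) n v' -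
    alternant (Suc r) n v * alternant (Suc r) m v')"
    by (simp only: algebra_simps)
  ultimately show ?thesis unfolding s by simp
qed

section \<open>The branching rule\<close>
lemma vandermonde_Suc:
  "vandermonde (Suc N) a = vandermonde N a * (\<Prod>i<N. a N - a i)"
proof -
  have "{(k, l). k < l \<and> l < Suc N} = {(k, l). k < l \<and> l < N} \<union> (\<lambda>k. (k, N)) ` {..<N}"
    by auto
  moreover have "finite {(k, l). k < l \<and> l < N}"
    by (rule finite_subset[of _ "{..<N} \<times> {..<N}"]) auto
  moreover have "{(k, l). k < l \<and> l < N} \<inter> (\<lambda>k. (k, N)) ` {..<N} = {}"
    by auto
  ultimately show ?thesis
    unfolding vandermonde_def by (simp add: prod.union_disjoint prod.reindex inj_on_def)
qed

lemma vandermonde_cong: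
  "(\<And>i. i < N \<Longrightarrow> a i = b i) \<Longrightarrow> vandermonde N a = vandermonde N b"
  unfolding vandermonde_def by (intro prod.cong) auto

lemma vandermonde_nonzero:
  "inj_on a {..<N} \<Longrightarrow> vandermonde N a \<noteq> 0"
proof (induction N)
  case (Suc N)
  then have "inj_on a {..<N}" by (auto intro: inj_on_subset)
  moreover have "a N \<noteq> a i" if "i < N" for i
    using inj_onD[OF Suc.prems, of N i] that by auto
  ultimately show ?case using Suc.IH by (auto simp: vandermonde_Suc)
qed (simp add: vandermonde_def)

text \<open>
  The Schur polynomial as a sum over Gelfand-Tsetlin patterns: the rows of a pattern are the
  successive interlacing tuples \<open>\<nu>\<close>, with \<open>n j \<le> \<nu> j < n (Suc j)\<close>. In this form both polynomiality and
  positivity are visible.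
\<close>
primrec branching_schur :: "nat \<Rightarrow> (nat \<Rightarrow> nat) \<Rightarrow> (nat \<Rightarrow> real) \<Rightarrow> real" where
  "branching_schur 0 n u = 1"
| "branching_schur (Suc N) n u =
     (\<Sum>\<nu>\<in>PiE {..<N} (\<lambda>j. {n j..<n (Suc j)}).
        u N ^ (n 0 + (\<Sum>j<N. n (Suc j) - 1 - \<nu> j)) * branching_schur N \<nu> u)"

lemma interlacing_strict_mono:
  fixes n \<nu> :: "nat \<Rightarrow> nat"
  assumes "\<nu> \<in> PiE {..<N} (\<lambda>j. {n j..<n (Suc j)})"
    and n: "strict_mono_on {..<Suc N} n"
  shows "strict_mono_on {..<N} \<nu>"
proof (rule strict_mono_onI)
  fix i j assume ij: "i \<in> {..<N}" "j \<in> {..<N}" "i < j"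
  then have "\<nu> i < n (Suc i)" "n j \<le> \<nu> j" using assms(1) by (auto simp: PiE_iff)
  moreover have "n (Suc i) \<le> n j"
    using ij strict_mono_on_leD[OF n, of "Suc i" j] by auto
  ultimately show "\<nu> i < \<nu> j" by simp
qed

lemma power_diff_step:
  fixes x z :: real
  assumes "a \<le> b"
  shows "x ^ b - z ^ (b - a) * x ^ a = (x - z) * (\<Sum>t\<in>{a..<b}. z ^ (b - 1 - t) * x ^ t)"
  using assms
proof (induction b rule: dec_induct)
  case (step b)
  have "(\<Sum>t\<in>{a..<Suc b}. z ^ (Suc b - 1 - t) * x ^ t) =
      x ^ b + (\<Sum>t\<in>{a..<b}. z * (z ^ (b - 1 - t) * x ^ t))"
    using step.hyps
    by (auto simp: power_Suc[symmetric] Suc_diff_Suc mult.assoc[symmetric] simp del: power_Suc intro!: sum.cong)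
  then have "(x - z) * (\<Sum>t\<in>{a..<Suc b}. z ^ (Suc b - 1 - t) * x ^ t) =
      (x - z) * x ^ b + z * (x ^ b - z ^ (b - a) * x ^ a)"
    unfolding step.IH by (simp add: sum_distrib_left[symmetric] algebra_simps)
  also have "\<dots> = x ^ Suc b - z ^ (Suc b - a) * x ^ a"
    using step.hyps by (simp add: Suc_diff_le algebra_simps)
  finally show ?case ..
qed simp

text \<open>
  Subtracting \<open>u N\<close> to the power \<open>n j - n (j - 1)\<close> times column \<open>j - 1\<close> from column \<open>j\<close> kills the last row
  except for its first entry. In each remaining entry the factor \<open>u i - u N\<close> splits off, and the
  quotient is a geometric sum over \<open>{n j..<n (Suc j)}\<close>; multilinearity turns these sums into the sum
  over \<open>\<nu>\<close>. The sign of the cofactor cancels against that of the factors \<open>u i - u N\<close>.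
\<close>
lemma alternant_branching:
  assumes n: "\<And>j. j < N \<Longrightarrow> n j \<le> n (Suc j)"
  shows "alternant (Suc N) n u = (\<Prod>i<N. u N - u i) *
    (\<Sum>\<nu>\<in>PiE {..<N} (\<lambda>j. {n j..<n (Suc j)}).
        u N ^ (n 0 + (\<Sum>j<N. n (Suc j) - 1 - \<nu> j)) * alternant N \<nu> u)"
proof -
  let ?z = "u N"
  define M where "M = mat (Suc N) (Suc N) (\<lambda>(i, j). u i ^ n j)"
  \<comment> \<open>The column operations are right multiplication by this unitriangular matrix.\<close>
  define P where "P = mat (Suc N) (Suc N)
    (\<lambda>(l, j). if l = j then 1 else if Suc l = j then - (?z ^ (n j - n l)) else 0)"
  define M' where "M' = mat (Suc N) (Suc N)
    (\<lambda>(i, j). if j = 0 then u i ^ n 0 else u i ^ n j - ?z ^ (n j - n (j - 1)) * u i ^ n (j - 1))"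
  have "det P = 1"
    by (subst det_upper_triangular[of _ "Suc N"]) (auto simp: P_def prod_list_diag_prod)
  moreover have "M' = M * P"
  proof (rule eq_matI)
    fix i j assume "i < dim_row (M * P)" "j < dim_col (M * P)"
    then have ij: "i < Suc N" "j < Suc N" by (auto simp: M_def P_def)
    have "(M * P) $$ (i, j) = (\<Sum>l<Suc N. u i ^ n l *
        (if l = j then 1 else if Suc l = j then - (?z ^ (n j - n l)) else 0))"
      using ij by (auto simp: M_def P_def scalar_prod_def atLeast0LessThan intro!: sum.cong)
    also have "\<dots> = (\<Sum>l<Suc N. (if l = j then u i ^ n l else 0) +
        (if l = j - 1 then (if j = 0 then 0 else - (?z ^ (n j - n l)) * u i ^ n l) else 0))"
      by (intro sum.cong) auto
    also have "\<dots> = M' $$ (i, j)"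
      using ij by (simp add: sum.distrib M'_def del: sum.lessThan_Suc)
    finally show "M' $$ (i, j) = (M * P) $$ (i, j)" ..
  qed (auto simp: M_def P_def M'_def)
  ultimately have "det M = det M'"
    by (simp add: det_mult[of _ "Suc N"] M_def P_def)
  also have "\<dots> = (\<Sum>j<Suc N. M' $$ (N, j) * cofactor M' N j)"
    by (rule laplace_expansion_row) (auto simp: M'_def)
  also have "\<dots> = (\<Sum>j<Suc N. if j = 0 then ?z ^ n 0 * cofactor M' N 0 else 0)"
  proof (intro sum.cong refl)
    fix j assume "j \<in> {..<Suc N}"
    moreover have "?z ^ n j = ?z ^ (n j - n (j - 1)) * ?z ^ n (j - 1)" if "j \<noteq> 0" "j \<le> N"
      using n[of "j - 1"] that by (simp flip: power_add)
    ultimately show "M' $$ (N, j) * cofactor M' N j = (if j = 0 then ?z ^ n 0 * cofactor M' N 0 else 0)"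
      by (auto simp: M'_def)
  qed
  also have "\<dots> = ?z ^ n 0 * ((-1) ^ N * det (mat_delete M' N 0))"
    by (simp add: cofactor_def del: sum.lessThan_Suc)
  also have "mat_delete M' N 0 = mat N N
      (\<lambda>(i, j). (u i - ?z) * (\<Sum>t\<in>{n j..<n (Suc j)}. ?z ^ (n (Suc j) - 1 - t) * u i ^ t))"
    by (rule eq_matI) (auto simp: mat_delete_def M'_def power_diff_step n)
  also have "det \<dots> = (\<Prod>i<N. u i - ?z) * (\<Sum>\<nu>\<in>PiE {..<N} (\<lambda>j. {n j..<n (Suc j)}).
      det (mat N N (\<lambda>(i, j). ?z ^ (n (Suc j) - 1 - \<nu> j) * u i ^ \<nu> j)))"
    by (simp add: det_row_factors det_column_sums)
  also have "(\<lambda>\<nu>. det (mat N N (\<lambda>(i, j). ?z ^ (n (Suc j) - 1 - \<nu> j) * u i ^ \<nu> j))) =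
      (\<lambda>\<nu>. ?z ^ (\<Sum>j<N. n (Suc j) - 1 - \<nu> j) * alternant N \<nu> u)"
  proof
    fix \<nu>
    have "det (mat N N (\<lambda>(i, j). ?z ^ (n (Suc j) - 1 - \<nu> j) * u i ^ \<nu> j)) =
        det (mat N N (\<lambda>(j, i). ?z ^ (n (Suc j) - 1 - \<nu> j) * u i ^ \<nu> j))"
      by (rule det_swap_indices)
    also have "\<dots> = ?z ^ (\<Sum>j<N. n (Suc j) - 1 - \<nu> j) * det (mat N N (\<lambda>(j, i). u i ^ \<nu> j))"
      by (simp add: det_row_factors power_sum)
    also have "det (mat N N (\<lambda>(j, i). u i ^ \<nu> j)) = alternant N \<nu> u"
      unfolding alternant_def by (rule det_swap_indices)
    finally show "det (mat N N (\<lambda>(i, j). ?z ^ (n (Suc j) - 1 - \<nu> j) * u i ^ \<nu> j)) =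
        ?z ^ (\<Sum>j<N. n (Suc j) - 1 - \<nu> j) * alternant N \<nu> u" .
  qed
  also have "(\<Prod>i<N. u i - ?z) = (-1) ^ N * (\<Prod>i<N. ?z - u i)"
  proof -
    have "(\<Prod>i<N. u i - ?z) = (\<Prod>i<N. (-1) * (?z - u i))" by (intro prod.cong) auto
    then show ?thesis by (simp only: prod.distrib prod_constant card_lessThan)
  qed
  finally show ?thesis
    by (simp add: alternant_def M_def power_add sum_distrib_left mult_ac flip: power_mult_distrib)
qed

theorem alternant_eq_vandermonde_branching_schur:
  assumes "strict_mono_on {..<N} n"
  shows "alternant N n u = vandermonde N u * branching_schur N n u"
  using assms
proof (induction N arbitrary: n)
  case 0
  then show ?case by (simp add: alternant_def vandermonde_def)
next
  case (Suc N)
  have le: "n j \<le> n (Suc j)" if "j < N" for j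
    using strict_mono_onD[OF Suc.prems, of j "Suc j"] that by simp
  have "alternant N \<nu> u = vandermonde N u * branching_schur N \<nu> u"
    if "\<nu> \<in> PiE {..<N} (\<lambda>j. {n j..<n (Suc j)})" for \<nu>
    by (rule Suc.IH[OF interlacing_strict_mono[OF that Suc.prems]])
  then show ?case
    using le by (simp add: alternant_branching vandermonde_Suc sum_distrib_left mult_ac)
qed

lemma branching_schur_cong:
  assumes "\<And>j. j < N \<Longrightarrow> n j = n' j" "\<And>i. i < N \<Longrightarrow> u i = u' i"
  shows "branching_schur N n u = branching_schur N n' u'"
  using assms
proof (induction N arbitrary: n n')
  case (Suc N)
  have "PiE {..<N} (\<lambda>j. {n j..<n (Suc j)}) = PiE {..<N} (\<lambda>j. {n' j..<n' (Suc j)})"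
    by (rule PiE_cong) (use Suc.prems in auto)
  moreover have "branching_schur N \<nu> u = branching_schur N \<nu> u'" for \<nu>
    by (rule Suc.IH) (use Suc.prems in auto)
  ultimately show ?case using Suc.prems by auto
qed simp

text \<open>
  For the exponents \<open>0, 1, 2, \<dots>\<close> every interlacing interval is a singleton and the sum has a single
  term.
\<close>
lemma branching_schur_staircase:
  "(\<And>j. j < N \<Longrightarrow> n j = j) \<Longrightarrow> branching_schur N n u = 1"
proof (induction N arbitrary: n)
  case (Suc N)
  have I: "PiE {..<N} (\<lambda>j. {n j..<n (Suc j)}) = {restrict (\<lambda>j. j) {..<N}}"
  proof -
    have "PiE {..<N} (\<lambda>j. {n j..<n (Suc j)}) = PiE {..<N} (\<lambda>j. {restrict (\<lambda>j. j) {..<N} j})"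
      by (rule PiE_cong) (use Suc.prems in auto)
    then show ?thesis by (simp only: PiE_singleton[OF restrict_extensional])
  qed
  show ?case
    using Suc.prems unfolding branching_schur.simps I by (simp add: Suc.IH)
qed simp

lemma alternant_staircase: "alternant N (\<lambda>j. j) u = vandermonde N u"
  by (subst alternant_eq_vandermonde_branching_schur)
    (auto simp: branching_schur_staircase strict_mono_on_def)

lemma branching_schur_nonneg:
  "(\<And>i. i < N \<Longrightarrow> u i \<ge> 0) \<Longrightarrow> branching_schur N n u \<ge> 0"
  by (induction N arbitrary: n) (auto intro!: sum_nonneg mult_nonneg_nonneg)

text \<open>
  One positive term suffices. If the last variable is positive, the smallest interlacing tuple
  \<open>\<nu> j = n j\<close> provides it. If the last variable is zero, only the largest one, \<open>\<nu> j = n (Suc j) - 1\<close>,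
  with weight \<open>0 ^ 0 = 1\<close> because \<open>n 0 = 0\<close>, can contribute; its initial run \<open>\<nu> j = j\<close> is shorter by one, but so is the
  list of zeros still to be treated.
\<close>
lemma branching_schur_pos:
  assumes "strict_mono_on {..<N} n" "\<And>j. j < N \<Longrightarrow> j < k \<Longrightarrow> n j = j"
    and "\<And>i. i < N \<Longrightarrow> u i \<ge> 0" "card {i \<in> {..<N}. u i = 0} \<le> k"
  shows "branching_schur N n u > 0"
  using assms
proof (induction N arbitrary: n k)
  case (Suc N)
  let ?I = "PiE {..<N} (\<lambda>j. {n j..<n (Suc j)})"
  let ?w = "\<lambda>\<nu>. u N ^ (n 0 + (\<Sum>j<N. n (Suc j) - 1 - \<nu> j)) * branching_schur N \<nu> u"
  have fin: "finite ?I" by (intro finite_PiE) auto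
  have nn: "?w \<nu> \<ge> 0" for \<nu>
    using Suc.prems(3) by (intro mult_nonneg_nonneg branching_schur_nonneg) auto
  have lt: "n j < n (Suc j)" if "j < N" for j
    using strict_mono_onD[OF Suc.prems(1), of j "Suc j"] that by simp
  have Z: "{i \<in> {..<Suc N}. u i = 0} = {i \<in> {..<N}. u i = 0} \<union> (if u N = 0 then {N} else {})"
    by (auto simp: less_Suc_eq)
  have "\<exists>\<nu>\<in>?I. ?w \<nu> > 0"
  proof (cases "u N = 0")
    case True
    have c: "card {i \<in> {..<N}. u i = 0} + 1 \<le> k"
      using Suc.prems(4) True unfolding Z by simp
    then have n0: "n 0 = 0" using Suc.prems(2)[of 0] by simp
    let ?\<nu> = "restrict (\<lambda>j. n (Suc j) - 1) {..<N}"
    have "n (Suc j) - 1 \<in> {n j..<n (Suc j)}" if "j < N" for j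
      using lt[OF that] by auto
    then have mem: "?\<nu> \<in> ?I" by auto
    have "branching_schur N ?\<nu> u > 0"
      by (rule Suc.IH[OF interlacing_strict_mono[OF mem Suc.prems(1)], of "k - 1"])
        (use Suc.prems(2,3) c in auto)
    then have "?w ?\<nu> > 0" using n0 True by simp
    then show ?thesis using mem by blast
  next
    case False
    let ?\<nu> = "restrict n {..<N}"
    have mem: "?\<nu> \<in> ?I" using lt by auto
    have "card {i \<in> {..<N}. u i = 0} \<le> k"
      using Suc.prems(4) False unfolding Z by simp
    then have "branching_schur N ?\<nu> u > 0"
      by (intro Suc.IH[OF interlacing_strict_mono[OF mem Suc.prems(1)], of k])
        (use Suc.prems(2,3) in auto)
    moreover have "u N > 0" using False Suc.prems(3)[of N] by simp
    ultimately show ?thesis using mem by (intro bexI[of _ ?\<nu>]) auto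
  qed
  then show ?case
    using fin nn by (auto intro!: sum_pos2)
qed simp

lemma isCont_branching_schur:
  assumes "\<And>i. i < N \<Longrightarrow> isCont (\<lambda>t. w t i) (t0 :: real)"
  shows "isCont (\<lambda>t. branching_schur N n (w t)) t0"
  using assms by (induction N arbitrary: n) (auto intro!: continuous_intros)

lemma polynomial_fun_branching_schur: "polynomial_fun N (branching_schur N n)"
proof (induction N arbitrary: n)
  case 0
  show ?case unfolding polynomial_fun_def
    by (intro exI[of _ "{\<lambda>_. 0}"] exI[of _ "\<lambda>_. 1"]) simp
next
  case (Suc N)
  have "\<forall>\<nu>. \<exists>A c. finite (A :: (nat \<Rightarrow> nat) set) \<and>
      (\<forall>u. branching_schur N \<nu> u = (\<Sum>\<alpha>\<in>A. c \<alpha> * (\<Prod>i<N. u i ^ \<alpha> i)))"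
    using Suc unfolding polynomial_fun_def by (intro allI)
  then obtain A c where "\<forall>\<nu>. finite (A \<nu> :: (nat \<Rightarrow> nat) set) \<and>
      (\<forall>u. branching_schur N \<nu> u = (\<Sum>\<alpha>\<in>A \<nu>. c \<nu> \<alpha> * (\<Prod>i<N. u i ^ \<alpha> i)))"
    unfolding choice_iff by (elim exE)
  then have A: "\<And>\<nu>. finite (A \<nu>)" and
    c: "\<And>\<nu> u. branching_schur N \<nu> u = (\<Sum>\<alpha>\<in>A \<nu>. c \<nu> \<alpha> * (\<Prod>i<N. u i ^ \<alpha> i))"
    by simp_all
  \<comment> \<open>A pair \<open>(\<nu>, \<alpha>)\<close> stands for the monomial \<open>\<alpha>\<close> of the \<open>\<nu>\<close>-th summand. The map \<open>h\<close> that appends the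
    exponent of the last variable need not be injective, so coefficients are collected along its fibres.\<close>
  define K where "K = Sigma (PiE {..<N} (\<lambda>j. {n j..<n (Suc j)})) A"
  define h where "h = (\<lambda>x. (snd x)(N := n 0 + (\<Sum>j<N. n (Suc j) - 1 - fst x j)))"
  define d where "d = (\<lambda>x. c (fst x) (snd x))"
  have fin: "finite K" using A unfolding K_def by (intro finite_SigmaI finite_PiE) auto
  have "branching_schur (Suc N) n u = (\<Sum>\<beta>\<in>h ` K. (\<Sum>x | x \<in> K \<and> h x = \<beta>. d x) * (\<Prod>i<Suc N. u i ^ \<beta> i))" for u
  proof -
    have "branching_schur (Suc N) n u = (\<Sum>x\<in>K. d x * (\<Prod>i<Suc N. u i ^ h x i))"
    proof -
      have "branching_schur (Suc N) n u = (\<Sum>\<nu>\<in>PiE {..<N} (\<lambda>j. {n j..<n (Suc j)}).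
          \<Sum>\<alpha>\<in>A \<nu>. d (\<nu>, \<alpha>) * (\<Prod>i<Suc N. u i ^ h (\<nu>, \<alpha>) i))"
        by (simp add: c d_def h_def sum_distrib_left sum_distrib_right mult_ac)
      also have "\<dots> = (\<Sum>(\<nu>, \<alpha>)\<in>K. d (\<nu>, \<alpha>) * (\<Prod>i<Suc N. u i ^ h (\<nu>, \<alpha>) i))"
        unfolding K_def by (rule sum.Sigma) (use A in \<open>auto intro!: finite_PiE\<close>)
      finally show ?thesis by (simp add: case_prod_beta')
    qed
    also have "\<dots> = (\<Sum>\<beta>\<in>h ` K. \<Sum>x | x \<in> K \<and> h x = \<beta>. d x * (\<Prod>i<Suc N. u i ^ h x i))"
      by (rule sum.image_gen[OF fin, of _ h])
    also have "\<dots> = (\<Sum>\<beta>\<in>h ` K. \<Sum>x | x \<in> K \<and> h x = \<beta>. d x * (\<Prod>i<Suc N. u i ^ \<beta> i))"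
      by (intro sum.cong refl) auto
    finally show ?thesis by (simp only: sum_distrib_right)
  qed
  then show ?case unfolding polynomial_fun_def
    by (intro exI[of _ "h ` K"] exI[of _ "\<lambda>\<beta>. \<Sum>x | x \<in> K \<and> h x = \<beta>. d x"]
      conjI allI finite_imageI[OF fin])
qed

section \<open>Identification with the Schur polynomial\<close>

declare branching_schur.simps(2) [simp del]

text \<open>
  Identities that are first proved at points with distinct coordinates extend to all points along the
  rays \<open>u i + t * real (Suc i)\<close> with \<open>t \<rightarrow> 0\<close> from the right: the coordinates are distinct for all but finitely many
  \<open>t\<close>, and they are positive if those of \<open>u\<close> are non-negative.
\<close>
lemma tendsto_branching_schur_perturbed:
  "((\<lambda>t. branching_schur N n (\<lambda>i. u i + t * real (Suc i))) \<longlongrightarrow> branching_schur N n u) (at_right 0)"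
proof -
  have "isCont (\<lambda>t. branching_schur N n (\<lambda>i. u i + t * real (Suc i))) 0"
    by (rule isCont_branching_schur) (auto intro!: continuous_intros)
  then show ?thesis
    by (simp add: isCont_def filterlim_at_split)
qed

lemma eventually_perturbed_inj:
  "\<forall>\<^sub>F t in at_right 0. inj_on (\<lambda>i. u i + t * real (Suc i)) {..<N}"
proof -
  have "\<forall>\<^sub>F t in at_right 0. i \<noteq> j \<longrightarrow> u i + t * real (Suc i) \<noteq> u j + t * real (Suc j)" for i j
  proof (cases "i = j")
    case False
    let ?t = "(u j - u i) / (real (Suc i) - real (Suc j))"
    have "t = ?t" if "u i + t * real (Suc i) = u j + t * real (Suc j)" for t
    proof -
      have "t * (real (Suc i) - real (Suc j)) = u j - u i"
        using that by (simp add: algebra_simps)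
      then show ?thesis using False by (simp add: eq_divide_eq)
    qed
    moreover have "\<forall>\<^sub>F t in at_right 0. t \<noteq> ?t"
      by (rule eventually_neq_at_within)
    ultimately show ?thesis
      by (auto elim!: eventually_mono)
  qed simp
  then have "\<forall>\<^sub>F t in at_right 0. \<forall>(i, j)\<in>{..<N} \<times> {..<N}. i \<noteq> j \<longrightarrow> u i + t * real (Suc i) \<noteq> u j + t * real (Suc j)"
    by (intro eventually_ball_finite) auto
  then show ?thesis
    by eventually_elim (auto simp: inj_on_def)
qed

lemma polynomial_fun_eqI:
  assumes "polynomial_fun N p" "polynomial_fun N q" "\<And>u. inj_on u {..<N} \<Longrightarrow> p u = q u"
  shows "p = q"
proof
  fix u :: "nat \<Rightarrow> real"
  let ?w = "\<lambda>t i. u i + t * real (Suc i)"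
  have lim: "((\<lambda>t. g (?w t)) \<longlongrightarrow> g u) (at_right 0)" if "polynomial_fun N g" for g
  proof -
    from that obtain A c where g: "finite A" "\<And>u. g u = (\<Sum>\<alpha>\<in>A. c \<alpha> * (\<Prod>i<N. u i ^ \<alpha> i))"
      unfolding polynomial_fun_def by blast
    have "isCont (\<lambda>t. g (?w t)) 0" unfolding g by (intro continuous_intros)
    then show ?thesis by (simp add: isCont_def filterlim_at_split)
  qed
  have "\<forall>\<^sub>F t in at_right 0. p (?w t) = q (?w t)"
    using eventually_perturbed_inj by eventually_elim (rule assms(3))
  then have "((\<lambda>t. q (?w t)) \<longlongrightarrow> p u) (at_right 0)"
    using lim[OF assms(1)] by (rule tendsto_cong[THEN iffD1])
  then show "p u = q u"
    using lim[OF assms(2)] by (rule tendsto_unique[OF trivial_limit_at_right_real])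
qed

theorem schur_eq_branching_schur:
  assumes "strict_mono_on {..<N} n"
  shows "schur N n = branching_schur N n"
  unfolding schur_def
proof (rule the_equality)
  show *: "polynomial_fun N (branching_schur N n) \<and> (\<forall>u. alternant N (\<lambda>j. j) u \<noteq> 0 \<longrightarrow>
      branching_schur N n u = alternant N n u / alternant N (\<lambda>j. j) u)"
    using assms by (simp add: polynomial_fun_branching_schur alternant_staircase
      alternant_eq_vandermonde_branching_schur)
  fix p assume p: "polynomial_fun N p \<and> (\<forall>u. alternant N (\<lambda>j. j) u \<noteq> 0 \<longrightarrow>
      p u = alternant N n u / alternant N (\<lambda>j. j) u)"
  show "p = branching_schur N n"
    by (rule polynomial_fun_eqI) (use p * vandermonde_nonzero in \<open>auto simp: alternant_staircase\<close>)
qed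

text \<open>
  Permuting the variables multiplies the alternant and the Vandermonde determinant by the same sign.
\<close>
lemma branching_schur_permute:
  assumes p: "p permutes {..<N}" and n: "strict_mono_on {..<N} n"
  shows "branching_schur N n (u \<circ> p) = branching_schur N n u"
proof -
  let ?w = "\<lambda>t i. u i + t * real (Suc i)"
  have "branching_schur N n (?w t \<circ> p) = branching_schur N n (?w t)" if "inj_on (?w t) {..<N}" for t
  proof -
    have V: "vandermonde N (?w t) \<noteq> 0" by (rule vandermonde_nonzero[OF that])
    have Vp: "vandermonde N (?w t \<circ> p) = signof p * vandermonde N (?w t)"
      unfolding alternant_staircase[symmetric] by (rule alternant_permute_points[OF p])
    have "(signof p * vandermonde N (?w t)) * branching_schur N n (?w t \<circ> p) =
        (signof p * vandermonde N (?w t)) * branching_schur N n (?w t)"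
      using alternant_permute_points[OF p, of n "?w t"]
      by (simp only: alternant_eq_vandermonde_branching_schur[OF n] Vp mult_ac)
    then show ?thesis using V by (auto split: if_splits)
  qed
  then have "\<forall>\<^sub>F t in at_right 0. branching_schur N n (?w t \<circ> p) = branching_schur N n (?w t)"
    using eventually_perturbed_inj by (rule eventually_mono[rotated])
  moreover have "((\<lambda>t. branching_schur N n (?w t \<circ> p)) \<longlongrightarrow> branching_schur N n (u \<circ> p)) (at_right 0)"
  proof -
    have "isCont (\<lambda>t. branching_schur N n (?w t \<circ> p)) 0"
      by (rule isCont_branching_schur) (auto intro!: continuous_intros)
    then show ?thesis by (simp add: isCont_def filterlim_at_split o_def)
  qed
  ultimately have "((\<lambda>t. branching_schur N n (?w t)) \<longlongrightarrow> branching_schur N n (u \<circ> p)) (at_right 0)"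
    by (rule tendsto_cong[THEN iffD1])
  then show ?thesis
    using tendsto_branching_schur_perturbed by (rule tendsto_unique[OF trivial_limit_at_right_real])
qed

section \<open>Monotonicity of ratios of Schur polynomials\<close>
lemma strict_mono_on_omit_entry:
  fixes m :: "nat \<Rightarrow> nat"
  assumes "strict_mono_on {..<Suc r} m"
  shows "strict_mono_on {..<r} (omit_entry m k)"
  using assms unfolding strict_mono_on_def omit_entry_def by auto

lemma strict_mono_on_insert_after:
  fixes m n :: "nat \<Rightarrow> nat"
  assumes m: "strict_mono_on {..<Suc r} m" and n: "strict_mono_on {..<Suc r} n" and k: "k \<le> r"
    and eq: "\<forall>j\<le>r. j \<noteq> k \<longrightarrow> n j = m j" and less: "m k < n k"
  shows "strict_mono_on {..<Suc (Suc r)} (insert_after m k (n k))"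
proof (rule strict_mono_onI)
  fix i j assume ij: "i \<in> {..<Suc (Suc r)}" "j \<in> {..<Suc (Suc r)}" "i < j"
  have m_less: "m a < m b" if "a < b" "b \<le> r" for a b
    using strict_mono_onD[OF m, of a b] that by simp
  have n_less: "n a < n b" if "a < b" "b \<le> r" for a b
    using strict_mono_onD[OF n, of a b] that by simp
  consider "j \<le> k" | "i \<le> k" "j = Suc k" | "i \<le> k" "Suc k < j" | "i = Suc k" "Suc k < j" | "Suc k < i"
    using \<open>i < j\<close> by linarith
  then show "insert_after m k (n k) i < insert_after m k (n k) j"
  proof cases
    case 1
    then show ?thesis using ij k m_less[of i j] by (simp add: insert_after_def)
  next
    case 2
    then have "m i \<le> m k" using k m_less[of i k] by (cases "i = k") auto
    then show ?thesis using 2 less by (simp add: insert_after_def)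
  next
    case 3
    then show ?thesis using ij m_less[of i "j - 1"] by (simp add: insert_after_def)
  next
    case 4
    then have "n k < n (j - 1)" using ij by (intro n_less) auto
    then show ?thesis using 4 ij eq[rule_format, of "j - 1"] by (simp add: insert_after_def)
  next
    case 5
    then show ?thesis using ij m_less[of "i - 1" "j - 1"] by (simp add: insert_after_def)
  qed
qed

text \<open>
  At a point with distinct positive coordinates this is the relation \<open>alternant_plucker\<close> divided by the common
  factor of the Vandermonde determinants: there the Schur polynomial of \<open>omit_entry m k\<close> is positive,
  which makes the leading block of Sylvester's identity invertible. Both sides are continuous, so the
  relation extends to all non-negative points.
\<close>
lemma branching_schur_plucker:
  fixes m n :: "nat \<Rightarrow> nat" and v :: "nat \<Rightarrow> real"
  assumes m: "strict_mono_on {..<Suc r} m" and n: "strict_mono_on {..<Suc r} n" and k: "k \<le> r"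
    and eq: "\<forall>j\<le>r. j \<noteq> k \<longrightarrow> n j = m j" and less: "m k < n k"
    and nonneg: "\<forall>i<Suc (Suc r). v i \<ge> 0"
  defines "v' \<equiv> v(r := v (Suc r))"
  shows "branching_schur (Suc r) m v * branching_schur (Suc r) n v' -
      branching_schur (Suc r) n v * branching_schur (Suc r) m v' =
    (v (Suc r) - v r) * branching_schur r (omit_entry m k) v *
      branching_schur (Suc (Suc r)) (insert_after m k (n k)) v"
proof -
  let ?R = "omit_entry m k" and ?w = "insert_after m k (n k)"
  define \<Phi> where "\<Phi> = (\<lambda>v. let v' = v(r := v (Suc r)) in
    branching_schur (Suc r) m v * branching_schur (Suc r) n v' -
    branching_schur (Suc r) n v * branching_schur (Suc r) m v')"
  define \<Psi> where "\<Psi> = (\<lambda>v. (v (Suc r) - v r) * branching_schur r ?R v * branching_schur (Suc (Suc r)) ?w v)"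
  note R = strict_mono_on_omit_entry[OF m, of k]
  note w = strict_mono_on_insert_after[OF m n k eq less]
  note factor = alternant_eq_vandermonde_branching_schur
  have generic: "\<Phi> x = \<Psi> x" if pos: "\<And>i. i < Suc (Suc r) \<Longrightarrow> x i > 0" and inj: "inj_on x {..<Suc (Suc r)}" for x
  proof -
    define x' where "x' = x(r := x (Suc r))"
    have V: "vandermonde r x \<noteq> 0"
      by (rule vandermonde_nonzero[OF inj_on_subset[OF inj]]) auto
    have Q: "(\<Prod>i<r. x r - x i) \<noteq> 0" "(\<Prod>i<r. x (Suc r) - x i) \<noteq> 0"
      using inj_onD[OF inj, of r] inj_onD[OF inj, of "Suc r"] by force+
    have "branching_schur r ?R x > 0"
    proof (rule branching_schur_pos[OF R, of 0])
      have "x i \<noteq> 0" if "i < r" for i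
        using pos[of i] that by simp
      then have "{i \<in> {..<r}. x i = 0} = {}" by auto
      then show "card {i \<in> {..<r}. x i = 0} \<le> 0" by simp
    qed (use pos in \<open>auto intro: less_imp_le\<close>)
    then have "alternant r ?R x \<noteq> 0"
      using V by (simp add: alternant_eq_vandermonde_branching_schur[OF R])
    from alternant_plucker[OF k eq this]
    have "(vandermonde r x * branching_schur r ?R x) *
        (vandermonde (Suc (Suc r)) x * branching_schur (Suc (Suc r)) ?w x) =
      (vandermonde (Suc r) x * branching_schur (Suc r) m x) * (vandermonde (Suc r) x' * branching_schur (Suc r) n x') -
      (vandermonde (Suc r) x * branching_schur (Suc r) n x) * (vandermonde (Suc r) x' * branching_schur (Suc r) m x')"
      by (simp only: factor[OF R] factor[OF w] factor[OF m] factor[OF n] x'_def)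
    moreover have "vandermonde (Suc r) x' = vandermonde r x * (\<Prod>i<r. x (Suc r) - x i)"
      unfolding vandermonde_Suc x'_def by (auto intro!: arg_cong2[of _ _ _ _ "(*)"] vandermonde_cong)
    ultimately have "(vandermonde r x * vandermonde r x * (\<Prod>i<r. x r - x i) * (\<Prod>i<r. x (Suc r) - x i)) * \<Psi> x =
        (vandermonde r x * vandermonde r x * (\<Prod>i<r. x r - x i) * (\<Prod>i<r. x (Suc r) - x i)) * \<Phi> x"
      unfolding \<Phi>_def \<Psi>_def Let_def x'_def[symmetric] vandermonde_Suc prod.lessThan_Suc
      by (simp only: algebra_simps)
    then show ?thesis using V Q by simp
  qed
  let ?x = "\<lambda>t i. v i + t * real (Suc i)"
  have "\<forall>\<^sub>F t in at_right 0. \<Phi> (?x t) = \<Psi> (?x t)"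
    using eventually_perturbed_inj[of v "Suc (Suc r)"] eventually_at_right_less[of "0 :: real"]
  proof eventually_elim
    case (elim t)
    have "v i + t * real (Suc i) > 0" if "i < Suc (Suc r)" for i
      by (rule add_nonneg_pos[OF nonneg[rule_format, OF that]]) (use elim in simp)
    then show ?case by (rule generic) (use elim in auto)
  qed
  moreover have \<Phi>_lim: "((\<lambda>t. \<Phi> (?x t)) \<longlongrightarrow> \<Phi> v) (at_right 0)"
    and \<Psi>_lim: "((\<lambda>t. \<Psi> (?x t)) \<longlongrightarrow> \<Psi> v) (at_right 0)"
  proof -
    have "isCont (\<lambda>t. ((?x t)(r := ?x t (Suc r))) i) 0" for i
      by (cases "i = r") (auto intro!: continuous_intros)
    moreover have "isCont (\<lambda>t. ?x t i) 0" for i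
      by (intro continuous_intros)
    ultimately have "isCont (\<lambda>t. \<Phi> (?x t)) 0" "isCont (\<lambda>t. \<Psi> (?x t)) 0"
      unfolding \<Phi>_def \<Psi>_def Let_def by (intro continuous_intros isCont_branching_schur; simp)+
    then show "((\<lambda>t. \<Phi> (?x t)) \<longlongrightarrow> \<Phi> v) (at_right 0)" "((\<lambda>t. \<Psi> (?x t)) \<longlongrightarrow> \<Psi> v) (at_right 0)"
      by (simp_all add: isCont_def filterlim_at_split)
  qed
  ultimately have "((\<lambda>t. \<Psi> (?x t)) \<longlongrightarrow> \<Phi> v) (at_right 0)"
    by (simp only: tendsto_cong)
  then have "\<Phi> v = \<Psi> v"
    using \<Psi>_lim by (rule tendsto_unique[OF trivial_limit_at_right_real])
  then show ?thesis by (simp add: \<Phi>_def \<Psi>_def v'_def Let_def)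
qed

text \<open>
  Both factors on the right of the Pluecker relation are positive: the changed entry lies behind the
  initial run \<open>0, \<dots>, K - 1\<close>, which the shorter and the longer tuple therefore inherit, and the new
  coordinate \<open>v (Suc r) > v r \<ge> 0\<close> adds no zero.
\<close>
lemma branching_schur_cross_less_last:
  fixes m n :: "nat \<Rightarrow> nat" and v :: "nat \<Rightarrow> real"
  assumes m: "strict_mono_on {..<Suc r} m" and n: "strict_mono_on {..<Suc r} n" and k: "k \<le> r"
    and eq: "\<forall>j\<le>r. j \<noteq> k \<longrightarrow> n j = m j" and less: "m k < n k"
    and K: "K \<le> k" "\<And>j. j < K \<Longrightarrow> m j = j"
    and nonneg: "\<And>i. i \<le> r \<Longrightarrow> v i \<ge> 0" and zeros: "card {i \<in> {..<Suc r}. v i = 0} \<le> K"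
    and lt: "v r < v (Suc r)"
  defines "v' \<equiv> v(r := v (Suc r))"
  shows "branching_schur (Suc r) n v * branching_schur (Suc r) m v' <
    branching_schur (Suc r) m v * branching_schur (Suc r) n v'"
proof -
  have nonneg': "\<forall>i<Suc (Suc r). v i \<ge> 0"
  proof -
    have "v (Suc r) \<ge> 0" using lt nonneg[of r] by linarith
    then show ?thesis using nonneg by (auto simp: less_Suc_eq)
  qed
  have "card {i \<in> {..<r}. v i = 0} \<le> card {i \<in> {..<Suc r}. v i = 0}"
    by (rule card_mono) auto
  then have "branching_schur r (omit_entry m k) v > 0"
    using K nonneg zeros
    by (intro branching_schur_pos[OF strict_mono_on_omit_entry[OF m], of K]) (auto simp: omit_entry_def)
  moreover have "{i \<in> {..<Suc (Suc r)}. v i = 0} = {i \<in> {..<Suc r}. v i = 0}"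
    using lt nonneg[of r] by (auto simp: less_Suc_eq)
  then have "branching_schur (Suc (Suc r)) (insert_after m k (n k)) v > 0"
    using K nonneg' zeros
    by (intro branching_schur_pos[OF strict_mono_on_insert_after[OF m n k eq less], of K])
      (auto simp: insert_after_def)
  ultimately have "0 < (v (Suc r) - v r) * branching_schur r (omit_entry m k) v *
      branching_schur (Suc (Suc r)) (insert_after m k (n k)) v"
    using lt by simp
  then show ?thesis
    using branching_schur_plucker[OF m n k eq less nonneg'] unfolding v'_def by linarith
qed

text \<open>
  By symmetry the moving coordinate may be transposed to the last place.
\<close>
lemma branching_schur_cross_less:
  fixes m n :: "nat \<Rightarrow> nat" and u v :: "nat \<Rightarrow> real"
  assumes m: "strict_mono_on {..<N} m" and n: "strict_mono_on {..<N} n" and k: "k < N"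
    and eq: "\<And>j. j < N \<Longrightarrow> j \<noteq> k \<Longrightarrow> n j = m j" and less: "m k < n k"
    and K: "K \<le> k" "\<And>j. j < K \<Longrightarrow> m j = j"
    and nonneg: "\<And>j. j < N \<Longrightarrow> u j \<ge> 0" and zeros: "card {j \<in> {..<N}. u j = 0} \<le> K"
    and i: "i < N" "\<And>j. j < N \<Longrightarrow> j \<noteq> i \<Longrightarrow> u j = v j" "u i < v i"
  shows "branching_schur N n u * branching_schur N m v < branching_schur N m u * branching_schur N n v"
proof -
  obtain r where r: "N = Suc r" using k by (cases N) auto
  define \<tau> where "\<tau> = transpose i r"
  have \<tau>: "\<tau> permutes {..<N}" unfolding \<tau>_def r
    by (rule permutes_swap_id) (use i r in auto)
  define x where "x = (u \<circ> \<tau>)(Suc r := v i)"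
  have lt: "\<tau> j < N" if "j < N" for j
    using permutes_in_image[OF \<tau>, of j] that by simp
  have "bij_betw \<tau> {j \<in> {..<N}. u (\<tau> j) = 0} {j \<in> {..<N}. u j = 0}"
    by (rule bij_betw_byWitness[of _ \<tau>]) (auto simp: lt, auto simp: \<tau>_def)
  then have "card {j \<in> {..<N}. u (\<tau> j) = 0} \<le> K"
    using zeros by (simp add: bij_betw_same_card)
  moreover have "{j \<in> {..<Suc r}. x j = 0} = {j \<in> {..<N}. u (\<tau> j) = 0}"
    by (auto simp: x_def r)
  ultimately have zeros': "card {j \<in> {..<Suc r}. x j = 0} \<le> K" by simp
  have "branching_schur (Suc r) n x * branching_schur (Suc r) m (x(r := x (Suc r))) <
      branching_schur (Suc r) m x * branching_schur (Suc r) n (x(r := x (Suc r)))"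
    by (rule branching_schur_cross_less_last[where k = k and K = K])
      (use m n k eq less K nonneg zeros' i lt r in \<open>auto simp: x_def \<tau>_def\<close>)
  moreover have "branching_schur (Suc r) l x = branching_schur N l u" if "strict_mono_on {..<N} l" for l
    unfolding r[symmetric] branching_schur_permute[OF \<tau> that, of u, symmetric]
    by (rule branching_schur_cong) (auto simp: x_def r)
  moreover have "branching_schur (Suc r) l (x(r := x (Suc r))) = branching_schur N l v"
    if "strict_mono_on {..<N} l" for l
    unfolding r[symmetric] branching_schur_permute[OF \<tau> that, of v, symmetric]
  proof (intro branching_schur_cong)
    fix j assume j: "j < N"
    show "(x(r := x N)) j = (v \<circ> \<tau>) j"
    proof (cases "j = r")
      case False
      then have "\<tau> j \<noteq> i" by (auto simp: \<tau>_def transpose_def)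
      then show ?thesis using False j r i(2)[OF lt[OF j]] by (simp add: x_def)
    qed (simp add: x_def \<tau>_def r)
  qed (rule refl)
  ultimately show ?thesis using m n by simp
qed

lemma strict_mono_on_nat_ge:
  fixes m :: "nat \<Rightarrow> nat"
  assumes "strict_mono_on {..<N} m" "j < N"
  shows "j \<le> m j"
  using assms(2)
proof (induction j)
  case (Suc j)
  then show ?case using strict_mono_onD[OF assms(1), of j "Suc j"] by simp
qed simp

text \<open>
  The tuple \<open>t l\<close> agrees with \<open>m\<close> below \<open>l\<close> and with \<open>n\<close> from \<open>l\<close> on; it is increasing because \<open>m \<le> n\<close>.
  Passing from \<open>t (Suc l)\<close> to \<open>t l\<close> raises only the \<open>l\<close>-th entry, so the quotient \<open>q l\<close> of the values at
  \<open>v\<close> and \<open>u\<close> grows, strictly where \<open>m l \<noteq> n l\<close>.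
\<close>
theorem branching_schur_ratio_less:
  fixes m n :: "nat \<Rightarrow> nat" and u v :: "nat \<Rightarrow> real"
  assumes m: "strict_mono_on {..<N} m" and n: "strict_mono_on {..<N} n"
    and le: "\<And>j. j < N \<Longrightarrow> m j \<le> n j" and differ: "l < N" "m l \<noteq> n l"
    and K: "\<And>j. j < N \<Longrightarrow> j < K \<Longrightarrow> n j = j"
    and nonneg: "\<And>j. j < N \<Longrightarrow> u j \<ge> 0" and zeros: "card {j \<in> {..<N}. u j = 0} \<le> K"
    and i: "i < N" "\<And>j. j < N \<Longrightarrow> j \<noteq> i \<Longrightarrow> u j = v j" "u i < v i"
  shows "branching_schur N n u / branching_schur N m u < branching_schur N n v / branching_schur N m v"
proof -
  have mK: "m j = j" if "j < N" "j < K" for j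
    using strict_mono_on_nat_ge[OF m \<open>j < N\<close>] le[of j] K[of j] that by simp
  define t where "t = (\<lambda>l j. if j < l then m j else n j)"
  have t: "strict_mono_on {..<N} (t l)" for l
  proof (rule strict_mono_onI)
    fix i j assume "i \<in> {..<N}" "j \<in> {..<N}" "i < j"
    then show "t l i < t l j"
      using strict_mono_onD[OF m, of i j] strict_mono_onD[OF n, of i j] le[of j] by (auto simp: t_def)
  qed
  have tK: "t l j = j" if "j < N" "j < K" for l j
    using that mK K by (simp add: t_def)
  have u: "branching_schur N (t l) u > 0" for l
    by (rule branching_schur_pos[OF t tK nonneg zeros])
  have v: "branching_schur N (t l) v > 0" for l
  proof (rule branching_schur_pos[OF t tK])
    show "v j \<ge> 0" if "j < N" for j
      using that nonneg[of j] i by (cases "j = i") (auto simp: less_imp_le order.strict_trans1)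
    have "card {j \<in> {..<N}. v j = 0} \<le> card {j \<in> {..<N}. u j = 0}"
      using i nonneg[of i] by (intro card_mono) (auto, metis order.strict_iff_not)
    then show "card {j \<in> {..<N}. v j = 0} \<le> K" using zeros by simp
  qed
  define q where "q = (\<lambda>l. branching_schur N (t l) v / branching_schur N (t l) u)"
  have step: "q (Suc l) < q l" if "l < N" "m l \<noteq> n l" for l
  proof -
    have "K \<le> l" using that mK[of l] K[of l] by force
    have id: "t (Suc l) j = j" if "j < K" for j
      using tK[of j] that \<open>K \<le> l\<close> \<open>l < N\<close> by simp
    have up: "t l l > t (Suc l) l" using that le[of l] by (simp add: t_def)
    have same: "t l j = t (Suc l) j" if "j \<noteq> l" for j using that by (auto simp: t_def)
    have "branching_schur N (t l) u * branching_schur N (t (Suc l)) v <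
        branching_schur N (t (Suc l)) u * branching_schur N (t l) v"
      by (rule branching_schur_cross_less[OF t t \<open>l < N\<close>, of _ _ K])
        (use \<open>K \<le> l\<close> id up same nonneg zeros i in auto)
    then show ?thesis using u v by (simp add: q_def field_simps)
  qed
  have "antimono q"
  proof (rule antimonoI, rule lift_Suc_antimono_le)
    fix l show "q (Suc l) \<le> q l"
    proof (cases "l < N \<and> m l \<noteq> n l")
      case False
      then have "branching_schur N (t (Suc l)) = branching_schur N (t l)"
        by (intro ext branching_schur_cong) (auto simp: t_def less_Suc_eq)
      then show ?thesis by (simp add: q_def)
    qed (simp add: step less_imp_le)
  qed
  then have "q 0 \<ge> q l" "q (Suc l) \<ge> q N"
    using differ by (simp_all add: antimonoD Suc_leI)
  with step[OF differ] have "q N < q 0" by simp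
  moreover have "branching_schur N (t N) = branching_schur N m"
    by (intro ext branching_schur_cong) (auto simp: t_def)
  moreover have "branching_schur N (t 0) = branching_schur N n"
    by (intro ext branching_schur_cong) (auto simp: t_def)
  ultimately show ?thesis
    using u[of 0] u[of N] v[of 0] v[of N] by (simp add: q_def field_simps)
qed

section \<open>Values on the diagonal and the upper bound\<close>
text \<open>
  The matrix entries \<open>(q ^ i) ^ n j = (q ^ n j) ^ i\<close> make the alternant a transposed Vandermonde
  determinant.
\<close>
lemma alternant_geometric:
  "alternant N n (\<lambda>i. c * q ^ i) = c ^ (\<Sum>j<N. n j) * vandermonde N (\<lambda>j. q ^ n j)"
proof -
  have "alternant N n (\<lambda>i. c * q ^ i) = det (mat N N (\<lambda>(j, i). c ^ n j * (q ^ n j) ^ i))"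
    unfolding alternant_def
    by (subst det_transpose[symmetric, of _ N])
      (auto intro!: arg_cong[of _ _ det] eq_matI simp: power_mult_distrib mult.commute simp flip: power_mult)
  also have "\<dots> = c ^ (\<Sum>j<N. n j) * alternant N (\<lambda>j. j) (\<lambda>j. q ^ n j)"
    by (simp add: det_row_factors power_sum alternant_def)
  finally show ?thesis by (simp add: alternant_staircase)
qed

text \<open>
  Divide the values along \<open>(c, c q, c q\<^sup>2, \<dots>)\<close> by one factor \<open>q - 1\<close> for each pair of indices and let
  \<open>q \<rightarrow> 1\<close>: each difference quotient of \<open>q ^ n l - q ^ n k\<close> tends to \<open>n l - n k\<close>.
\<close>
lemma branching_schur_principal:
  assumes n: "strict_mono_on {..<N} n"
  shows "c ^ (\<Sum>j<N. j) * vandermonde N real * branching_schur N n (\<lambda>_. c) =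
    c ^ (\<Sum>j<N. n j) * vandermonde N (\<lambda>j. real (n j))"
proof -
  let ?P = "{(k, l). k < l \<and> l < N}"
  define D where "D = (\<lambda>a q. \<Prod>(k, l)\<in>?P. (q ^ a l - q ^ a k) / (q - 1) :: real)"
  have D: "vandermonde N (\<lambda>j. q ^ a j) = (\<Prod>(k, l)\<in>?P. q - 1) * D a q" if "q \<noteq> 1" for a q
    using that unfolding D_def vandermonde_def prod.distrib[symmetric] by (intro prod.cong) auto
  have lim: "((\<lambda>q. D a q) \<longlongrightarrow> vandermonde N (\<lambda>j. real (a j))) (at 1)" for a
  proof -
    have "((\<lambda>q. (q ^ a l - q ^ a k) / (q - 1)) \<longlongrightarrow> real (a l) - real (a k)) (at (1 :: real))" for k l
    proof -
      have "((\<lambda>q. q ^ a l - q ^ a k) has_real_derivative real (a l) - real (a k)) (at 1)"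
        by (auto intro!: derivative_eq_intros)
      then show ?thesis by (simp add: has_field_derivative_iff)
    qed
    then show ?thesis unfolding D_def vandermonde_def
      by (intro tendsto_prod) (auto simp: case_prod_beta)
  qed
  have "c ^ (\<Sum>j<N. j) * D (\<lambda>j. j) q * branching_schur N n (\<lambda>i. c * q ^ i) = c ^ (\<Sum>j<N. n j) * D n q"
    if "q \<noteq> 1" for q
  proof -
    have "vandermonde N (\<lambda>i. c * q ^ i) * branching_schur N n (\<lambda>i. c * q ^ i) =
        c ^ (\<Sum>j<N. n j) * vandermonde N (\<lambda>j. q ^ n j)"
      by (simp only: alternant_geometric alternant_eq_vandermonde_branching_schur[OF n, symmetric])
    moreover have "vandermonde N (\<lambda>i. c * q ^ i) = c ^ (\<Sum>j<N. j) * vandermonde N (\<lambda>j. q ^ j)"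
      by (simp only: alternant_geometric alternant_staircase[symmetric])
    ultimately have "(\<Prod>(k, l)\<in>?P. q - 1) *
        (c ^ (\<Sum>j<N. j) * D (\<lambda>j. j) q * branching_schur N n (\<lambda>i. c * q ^ i)) =
        (\<Prod>(k, l)\<in>?P. q - 1) * (c ^ (\<Sum>j<N. n j) * D n q)"
      unfolding D[OF that] by (simp only: mult_ac)
    moreover have "(\<Prod>(k, l)\<in>?P. q - 1) \<noteq> 0" using that by simp
    ultimately show ?thesis by (rule mult_left_cancel[THEN iffD1, rotated])
  qed
  then have "\<forall>\<^sub>F q in at 1. c ^ (\<Sum>j<N. j) * D (\<lambda>j. j) q * branching_schur N n (\<lambda>i. c * q ^ i) =
      c ^ (\<Sum>j<N. n j) * D n q"
    by (simp add: eventually_at_filter)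
  moreover have "((\<lambda>q. c ^ (\<Sum>j<N. j) * D (\<lambda>j. j) q * branching_schur N n (\<lambda>i. c * q ^ i)) \<longlongrightarrow>
      c ^ (\<Sum>j<N. j) * vandermonde N real * branching_schur N n (\<lambda>_. c)) (at 1)"
  proof -
    have "isCont (\<lambda>q. branching_schur N n (\<lambda>i. c * q ^ i)) 1"
      by (rule isCont_branching_schur) (intro continuous_intros)
    then have "((\<lambda>q. branching_schur N n (\<lambda>i. c * q ^ i)) \<longlongrightarrow> branching_schur N n (\<lambda>_. c)) (at 1)"
      by (simp add: isCont_def)
    then show ?thesis using lim[of "\<lambda>j. j"] by (intro tendsto_intros)
  qed
  ultimately have "((\<lambda>q. c ^ (\<Sum>j<N. n j) * D n q) \<longlongrightarrow>
      c ^ (\<Sum>j<N. j) * vandermonde N real * branching_schur N n (\<lambda>_. c)) (at 1)"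
    by (simp only: tendsto_cong)
  then show ?thesis
    using tendsto_mult[OF tendsto_const lim] by (rule tendsto_unique[OF at_neq_bot])
qed

lemma branching_schur_ratio_diagonal:
  assumes n: "strict_mono_on {..<N} n" and m: "strict_mono_on {..<N} m" and c: "c > 0"
  shows "branching_schur N n (\<lambda>_. c) / branching_schur N m (\<lambda>_. c) =
    c powr real_of_int (tuple_diff N n m) * vandermonde N (\<lambda>j. real (n j)) / vandermonde N (\<lambda>j. real (m j))"
proof -
  let ?s = "c ^ (\<Sum>j<N. j) * vandermonde N real"
  have s: "?s \<noteq> 0" using c vandermonde_nonzero[of real N] by (simp add: inj_on_def)
  have "real_of_int (tuple_diff N n m) = real (\<Sum>j<N. n j) - real (\<Sum>j<N. m j)"
    by (simp add: tuple_diff_def sum_subtractf)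
  then have "c powr real_of_int (tuple_diff N n m) = c ^ (\<Sum>j<N. n j) / c ^ (\<Sum>j<N. m j)"
    using c by (simp only: powr_diff powr_realpow)
  moreover have "branching_schur N n (\<lambda>_. c) / branching_schur N m (\<lambda>_. c) =
      (?s * branching_schur N n (\<lambda>_. c)) / (?s * branching_schur N m (\<lambda>_. c))"
    by (rule mult_divide_mult_cancel_left[OF s, symmetric])
  ultimately show ?thesis by (simp add: branching_schur_principal n m)
qed

lemma nondecreasing_coords_box_bound:
  assumes mono: "nondecreasing_coords N ({..<N} \<rightarrow>\<^sub>E {0<..}) f"
    and u: "u \<in> {..<N} \<rightarrow>\<^sub>E {0<..c}"
  shows "f u \<le> f (\<lambda>i\<in>{..<N}. c)"
proof -
  define w where "w = (\<lambda>l. \<lambda>i\<in>{..<N}. if i < l then c else u i)"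
  have u_bounds: "0 < u i \<and> u i \<le> c" if "i < N" for i
    using PiE_mem[OF u, of i] that by simp
  have w: "w l \<in> {..<N} \<rightarrow>\<^sub>E {0<..}" for l
    using u_bounds by (force simp: w_def)
  have "f (w 0) \<le> f (w l)" if "l \<le> N" for l
    using that
  proof (induction l)
    case (Suc l)
    have "f (w l) \<le> f (w (Suc l))"
    proof (cases "u l = c")
      case True
      then have "w l = w (Suc l)" by (auto simp: w_def fun_eq_iff less_Suc_eq)
      then show ?thesis by simp
    next
      case False
      then have "w l l < w (Suc l) l" using u_bounds[of l] Suc.prems by (simp add: w_def)
      moreover have "\<forall>j<N. j \<noteq> l \<longrightarrow> w l j = w (Suc l) j" by (auto simp: w_def)
      ultimately show ?thesis
        using mono w Suc.prems unfolding nondecreasing_coords_def by (meson Suc_le_lessD)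
    qed
    then show ?case using Suc by simp
  qed simp
  from this[of N] have "f (w 0) \<le> f (w N)" by simp
  moreover have "w 0 = u" using PiE_restrict[OF u] by (simp add: w_def)
  moreover have "w N = (\<lambda>i\<in>{..<N}. c)" by (auto simp: w_def)
  ultimately show ?thesis by simp
qed

section \<open>The ratio on the extended domain\<close>
lemma few_zeros_0: "few_zeros N 0 = {..<N} \<rightarrow>\<^sub>E {0<..}"
proof (intro Set.set_eqI iffI)
  fix u assume u: "u \<in> few_zeros N 0"
  then have "{i \<in> {..<N}. u i = 0} = {}" by (simp add: few_zeros_def)
  then have "u i \<noteq> 0" "u i \<ge> 0" if "i < N" for i
    using u that by (auto simp: few_zeros_def PiE_iff)
  then have "u i > 0" if "i < N" for i
    using that by (metis order_le_less)
  then show "u \<in> {..<N} \<rightarrow>\<^sub>E {0<..}"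
    using u by (simp add: few_zeros_def PiE_iff)
next
  fix u assume u: "u \<in> {..<N} \<rightarrow>\<^sub>E {0 :: real<..}"
  then have pos: "u i > 0" if "i < N" for i using that by (simp add: PiE_iff)
  then have "{i \<in> {..<N}. u i = 0} = {}" by force
  then show "u \<in> few_zeros N 0"
    using u pos by (simp add: few_zeros_def PiE_iff less_imp_le)
qed

theorem schur_ratio_strictly_increasing:
  fixes m n :: "nat \<Rightarrow> nat"
  assumes m: "strict_mono_on {..<N} m" and n: "strict_mono_on {..<N} n"
    and le: "\<forall>j<N. m j \<le> n j" and differ: "\<exists>j<N. m j \<noteq> n j" and k: "\<forall>j<k. n j = j"
  shows "strictly_increasing_coords N (few_zeros N k) (\<lambda>u. schur N n u / schur N m u)"
  unfolding strictly_increasing_coords_def schur_eq_branching_schur[OF m] schur_eq_branching_schur[OF n]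
proof (intro ballI allI impI, elim conjE)
  fix u v i
  assume uv: "u \<in> few_zeros N k" "v \<in> few_zeros N k" "i < N" "\<forall>j<N. j \<noteq> i \<longrightarrow> u j = v j" "u i < v i"
  obtain l where l: "l < N" "m l \<noteq> n l" using differ by blast
  show "branching_schur N n u / branching_schur N m u < branching_schur N n v / branching_schur N m v"
  proof (rule branching_schur_ratio_less[OF m n])
    show "u j \<ge> 0" if "j < N" for j
      using uv(1) that by (auto simp: few_zeros_def PiE_iff)
    show "card {j \<in> {..<N}. u j = 0} \<le> k"
      using uv(1) by (simp add: few_zeros_def)
  qed (use l le k uv(3-5) in simp_all)
qed

lemma schur_pos_few_zeros:
  assumes m: "strict_mono_on {..<N} m" and k: "\<forall>j<N. j < k \<longrightarrow> m j = j" and u: "u \<in> few_zeros N k"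
  shows "schur N m u > 0"
  unfolding schur_eq_branching_schur[OF m]
  by (rule branching_schur_pos[OF m, of k]) (use k u in \<open>auto simp: few_zeros_def PiE_iff\<close>)

theorem theorem2p11:
  fixes N :: nat and m n :: "nat \<Rightarrow> nat" and f :: "(nat \<Rightarrow> real) \<Rightarrow> real"
  assumes "N \<ge> 1"
    and "strict_mono_on {..<N} m" and "strict_mono_on {..<N} n"
    and "\<exists>j<N. m j \<noteq> n j"
    and "\<forall>j<N. m j \<le> n j"
    and f_def: "f = (\<lambda>u. schur N n u / schur N m u)"
  shows
    "(quotient_defined_on ({..<N} \<rightarrow>\<^sub>E {0<..}) (schur N m) \<and>
      symmetric_on N ({..<N} \<rightarrow>\<^sub>E {0<..}) f \<and>
      strictly_increasing_coords N ({..<N} \<rightarrow>\<^sub>E {0<..}) f \<and>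
      (\<forall>\<rho>::real. \<rho> > 0 \<longrightarrow>
        (\<forall>u \<in> {..<N} \<rightarrow>\<^sub>E {0<..sqrt \<rho>}.
           f u \<le> \<rho> powr (real_of_int (tuple_diff N n m) / 2)
                  * vandermonde N (\<lambda>j. real (n j)) / vandermonde N (\<lambda>j. real (m j))) \<and>
        \<rho> powr (real_of_int (tuple_diff N n m) / 2)
          * vandermonde N (\<lambda>j. real (n j)) / vandermonde N (\<lambda>j. real (m j))
          = f (\<lambda>i\<in>{..<N}. sqrt \<rho>)))
     \<and>
     (\<forall>k\<le>N. (\<forall>j<k. n j = j) \<and> (k < N \<longrightarrow> n k > k) \<longrightarrow>
        quotient_defined_on (few_zeros N k) (schur N m) \<and>
        nondecreasing_coords N (few_zeros N k) f)
     \<and>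
     (\<forall>k\<le>N. (\<forall>j<k. m j = j \<and> n j = j) \<and> (k < N \<longrightarrow> m k > k \<and> n k > k) \<longrightarrow>
        quotient_defined_on (few_zeros N k) (schur N m) \<and>
        strictly_increasing_coords N (few_zeros N k) f)"
proof -
  note m = assms(2) and n = assms(3) and le = assms(5)
  have weaken: "nondecreasing_coords N X f" if "strictly_increasing_coords N X f" for X
    using that unfolding strictly_increasing_coords_def nondecreasing_coords_def
    by (blast intro: less_imp_le)
  have core: "quotient_defined_on (few_zeros N k) (schur N m) \<and>
      strictly_increasing_coords N (few_zeros N k) f" if k: "\<forall>j<k. n j = j" for k
  proof
    have "m j = j" if "j < N" "j < k" for j
      using strict_mono_on_nat_ge[OF m that(1)] le k that by (metis le_antisym)
    then show "quotient_defined_on (few_zeros N k) (schur N m)"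
      unfolding quotient_defined_on_def
      using schur_pos_few_zeros[OF m, of k] by (metis less_irrefl)
    show "strictly_increasing_coords N (few_zeros N k) f"
      unfolding f_def by (rule schur_ratio_strictly_increasing[OF m n le assms(4) k])
  qed
  have orthant: "quotient_defined_on ({..<N} \<rightarrow>\<^sub>E {0<..}) (schur N m)"
      "strictly_increasing_coords N ({..<N} \<rightarrow>\<^sub>E {0<..}) f"
    using core[of 0] by (simp_all add: few_zeros_0)
  have symmetric: "symmetric_on N ({..<N} \<rightarrow>\<^sub>E {0<..}) f"
    unfolding symmetric_on_def f_def schur_eq_branching_schur[OF m] schur_eq_branching_schur[OF n]
    by (simp add: branching_schur_permute m n)
  have diagonal: "\<rho> powr (real_of_int (tuple_diff N n m) / 2)
        * vandermonde N (\<lambda>j. real (n j)) / vandermonde N (\<lambda>j. real (m j))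
        = f (\<lambda>i\<in>{..<N}. sqrt \<rho>)" if "\<rho> > 0" for \<rho> :: real
  proof -
    have "f (\<lambda>i\<in>{..<N}. sqrt \<rho>) =
        branching_schur N n (\<lambda>_. sqrt \<rho>) / branching_schur N m (\<lambda>_. sqrt \<rho>)"
      unfolding f_def schur_eq_branching_schur[OF m] schur_eq_branching_schur[OF n]
      by (intro arg_cong2[of _ _ _ _ "(/)"] branching_schur_cong) auto
    also have "\<dots> = sqrt \<rho> powr real_of_int (tuple_diff N n m)
        * vandermonde N (\<lambda>j. real (n j)) / vandermonde N (\<lambda>j. real (m j))"
      by (rule branching_schur_ratio_diagonal[OF n m]) (use that in simp)
    also have "sqrt \<rho> powr real_of_int (tuple_diff N n m) = \<rho> powr (real_of_int (tuple_diff N n m) / 2)"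
      using that by (simp add: powr_half_sqrt[symmetric] powr_powr)
    finally show ?thesis ..
  qed
  have bound: "f u \<le> \<rho> powr (real_of_int (tuple_diff N n m) / 2)
        * vandermonde N (\<lambda>j. real (n j)) / vandermonde N (\<lambda>j. real (m j))"
    if "\<rho> > 0" "u \<in> {..<N} \<rightarrow>\<^sub>E {0<..sqrt \<rho>}" for \<rho> :: real and u
    unfolding diagonal[OF that(1)]
    by (rule nondecreasing_coords_box_bound[OF weaken[OF orthant(2)] that(2)])
  show ?thesis
    by (intro conjI allI impI ballI)
      (use orthant symmetric diagonal bound core weaken in blast)+
qed

end
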